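(* Let $a,b,c,d:(0,\infty)\to\mathbb{R}$ be Borel measurable functions. Assume that there exists a measurable set $M\subset(0,\infty)^2$ such that $l_2(M)=0$ and $$a(x)+b(y)=c(x+y)+d\left(\frac{x}{y}\right)\qquad\text{for all }(x,y)\in(0,\infty)^2\setminus M.$$ Then there exist real constants $\lambda,\varkappa_1,\varkappa_2,\alpha,\beta,\gamma,\delta$ satisfying $\alpha+\beta=\gamma+\delta$ such that for $l_1$-almost all $x\in(0,\infty)$ $$a(x)=\lambda x+\varkappa_1\log(x)+\alpha,\qquad b(x)=\lambda x+\varkappa_2\log(x)+\beta,$$ $$c(x)=\lambda x+(\varkappa_1+\varkappa_2)\log(x)+\gamma,\qquad d(x)=\varkappa_1\log\left(\frac{x}{x+1}\right)-\varkappa_2\log(1+x)+\delta.$$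
   Context: $l_n$ denotes the Lebesgue measure on $\mathbb{R}^n$; $\log$ is the natural logarithm. *)

theory Defs
  imports "HOL-Analysis.Analysis"
begin

end

theory Submission
  imports Defs
begin

text \<open>
  The equation is freed of \<open>d\<close> by a dilation: \<open>x / y\<close> does not change when both variables are
  multiplied by \<open>t\<close>, so subtracting the equation at \<open>(x, y)\<close> from the one at \<open>(t x, t y)\<close> leaves,
  for \<open>A x = a (t x) - a x\<close> and similarly \<open>B\<close>, \<open>C\<close>, the Pexider equation
  \<open>A x + B y = C (x + y)\<close> almost everywhere. Its measurable solutions are affine with a common
  slope (\<open>pexider_AE\<close>), hence \<open>a (t x) - a x = l t * x + p t\<close> for almost all \<open>x\<close>, with the same
  \<open>l\<close> for \<open>a\<close>, \<open>b\<close> and \<open>c\<close>. Dilating by \<open>s\<close> and then by \<open>t\<close> shows \<open>l (t s) = l t * s + l s\<close>;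
  as the left side is symmetric in \<open>s\<close> and \<open>t\<close>, \<open>l t = \<Lambda> (t - 1)\<close>. So \<open>a x - \<Lambda> x\<close>
  has increments under dilations that do not depend on \<open>x\<close>, and as a function of \<open>ln x\<close> it is affine
  (\<open>dilation_increments\<close>). This gives \<open>a\<close>, \<open>b\<close>, \<open>c\<close>, and then \<open>d\<close> from the equation on a
  generic line \<open>x = x0\<close>.

  Both the additive and the multiplicative step rest on one fact
  (\<open>affine_if_increments_constant\<close>): if \<open>f\<close> is measurable and, for each \<open>t > 0\<close>,
  \<open>f (x + t) - f x = p t\<close> for almost all \<open>x\<close>, then \<open>f\<close> is affine almost everywhere. Here \<open>p\<close> is
  additive. A set on which \<open>f\<close> is bounded and which fills more than three quarters of a unit interval
  meets its small translates in positive measure, so \<open>p\<close> is bounded near 0 and therefore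
  linear. After subtraction of a linear function \<open>f\<close> is invariant under each translation almost
  everywhere, and Fubini's theorem makes it constant.

  The exceptional null set depends on \<open>t\<close> throughout, so no step may evaluate a function at a
  prescribed point; points are only chosen from sets of full measure.
\<close>

section \<open>Almost everywhere statements on the line\<close>

lemma AE_lborel_iff_negligible: "(AE x in lborel. P x) \<longleftrightarrow> negligible {x::real. \<not> P x}"
proof -
  have "(AE x in lborel. P x) \<longleftrightarrow> (AE x in lebesgue. P x)"
    by (simp add: AE_completion_iff)
  also have "\<dots> \<longleftrightarrow> negligible {x. \<not> P x}"
    by (simp add: eventually_ae_filter_negligible) (auto intro: negligible_subset)
  finally show ?thesis .
qed

text \<open>
  The exceptional set for \<open>P (f x)\<close> is covered by the image under \<open>g\<close> of the one for \<open>P y\<close>, and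
  differentiable functions map null sets to null sets. All changes of variable below (translations,
  dilations, \<open>exp\<close>, \<open>ln\<close>, \<open>x \<mapsto> c / x\<close>) are instances.
\<close>

lemma AE_lborel_substitution:
  fixes f g :: "real \<Rightarrow> real"
  assumes P: "AE y in lborel. P y"
    and g: "g differentiable_on T"
    and inv: "\<And>x. x \<in> S \<Longrightarrow> f x \<in> T \<and> g (f x) = x"
  shows "AE x in lborel. x \<in> S \<longrightarrow> P (f x)"
proof -
  have "negligible (g ` (T \<inter> {y. \<not> P y}))"
    using P g by (intro negligible_differentiable_image_negligible)
      (auto simp: AE_lborel_iff_negligible intro: negligible_subset differentiable_on_subset)
  moreover have "{x. \<not> (x \<in> S \<longrightarrow> P (f x))} \<subseteq> g ` (T \<inter> {y. \<not> P y})"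
    using inv by (force simp: image_iff)
  ultimately show ?thesis
    unfolding AE_lborel_iff_negligible by (rule negligible_subset)
qed

lemma AE_lborel_translate:
  fixes s :: real
  assumes "AE x in lborel. P x"
  shows "AE x in lborel. P (x + s)"
  using AE_lborel_substitution[OF assms, of "\<lambda>x. x - s" UNIV UNIV "\<lambda>x. x + s"]
  by (simp add: differentiable_on_def)

lemma AE_lborel_scale:
  fixes t :: real
  assumes "AE x in lborel. P x" "t \<noteq> 0"
  shows "AE x in lborel. P (t * x)"
  using AE_lborel_substitution[OF assms(1), of "\<lambda>x. x / t" UNIV UNIV "\<lambda>x. t * x"] assms(2)
  by (simp add: differentiable_on_def)

lemma AE_lborel_ex:
  fixes u v :: real
  assumes "AE x in lborel. x \<in> S \<longrightarrow> P x" "u < v" "{u<..<v} \<subseteq> S"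
  shows "\<exists>x\<in>{u<..<v}. P x"
proof (rule ccontr)
  assume "\<not> ?thesis"
  then have "{u<..<v} \<subseteq> {x. \<not> (x \<in> S \<longrightarrow> P x)}"
    using assms(3) by auto
  then have "negligible {u<..<v}"
    using assms(1) unfolding AE_lborel_iff_negligible by (rule negligible_subset[rotated])
  then show False
    using assms(2) open_not_negligible[of "{u<..<v}"] by auto
qed

lemma AE_lborel_ex_pos:
  fixes e :: real
  assumes "AE x in lborel. 0 < x \<longrightarrow> P x" "0 < e"
  shows "\<exists>x. 0 < x \<and> x < e \<and> P x"
  using AE_lborel_ex[of "{0<..}" P 0 e] assms by (auto simp: subset_eq)

lemma affine_AE_eq:
  fixes k m k' m' :: real
  assumes "AE x in lborel. 0 < x \<longrightarrow> k * x + m = k' * x + m'"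
  shows "k = k'" "m = m'"
proof -
  have *: "AE x in lborel. x \<in> {0<..} \<longrightarrow> k * x + m = k' * x + m'"
    using assms by simp
  obtain x where x: "x \<in> {0<..<1}" "k * x + m = k' * x + m'"
    using AE_lborel_ex[OF *, of 0 1] by (auto simp: subset_eq)
  obtain y where y: "y \<in> {1<..<2}" "k * y + m = k' * y + m'"
    using AE_lborel_ex[OF *, of 1 2] by (auto simp: subset_eq)
  have "(k - k') * (y - x) = 0" using x y by (simp add: algebra_simps)
  then show "k = k'" using x y by auto
  then show "m = m'" using x by simp
qed

section \<open>Measurable functions with constant increments\<close>

text \<open>
  The function \<open>q t = p t - p 1 * t\<close> is additive and vanishes at 1, so it has period 1. Being bounded
  near 0, it is bounded on the unit interval and by periodicity everywhere; but
  \<open>q (n t) = n * q t\<close> is bounded in \<open>n\<close> only if \<open>q t = 0\<close>.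
\<close>

lemma additive_bounded_linear:
  fixes p :: "real \<Rightarrow> real"
  assumes add: "\<And>s t. 0 < s \<Longrightarrow> 0 < t \<Longrightarrow> p (s + t) = p s + p t"
    and e: "0 < e" and bd: "\<And>t. 0 < t \<Longrightarrow> t < e \<Longrightarrow> \<bar>p t\<bar> \<le> B"
    and t: "0 < t"
  shows "p t = p 1 * t"
proof -
  define q where "q = (\<lambda>t. p t - p 1 * t)"
  have qadd: "q (s + t) = q s + q t" if "0 < s" "0 < t" for s t
    using add[OF that] by (simp add: q_def algebra_simps)
  have qmult: "q (real (Suc n) * t) = real (Suc n) * q t" if "0 < t" for n t
  proof (induction n)
    case (Suc n)
    have "q (real (Suc (Suc n)) * t) = q (real (Suc n) * t + t)"
      by (simp add: algebra_simps)
    also have "\<dots> = q (real (Suc n) * t) + q t"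
      using that by (intro qadd) auto
    finally show ?case using Suc by (simp add: algebra_simps)
  qed simp
  have q1: "q 1 = 0" by (simp add: q_def)
  have qper: "q (s + real n) = q s" if "0 < s" for s n
  proof (induction n)
    case (Suc n)
    have "q (s + real (Suc n)) = q ((s + real n) + 1)" by (simp add: algebra_simps)
    also have "\<dots> = q (s + real n) + q 1" using that by (intro qadd) auto
    finally show ?case using Suc q1 by simp
  qed simp
  obtain m :: nat where m: "1 / e < real (Suc m)"
    using reals_Archimedean2[of "1/e"] by (metis less_Suc_eq less_trans of_nat_less_iff)
  define C where "C = real (Suc m) * (B + \<bar>p 1\<bar> * e)"
  have small: "\<bar>q s\<bar> \<le> C" if s: "0 < s" "s \<le> 1" for s
  proof -
    define r where "r = s / real (Suc m)"
    have "1 < real (Suc m) * e" using m e by (simp add: field_simps)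
    then have r: "0 < r" "r < e" using s by (auto simp: r_def divide_simps mult.commute)
    have "\<bar>q r\<bar> \<le> \<bar>p r\<bar> + \<bar>p 1\<bar> * r"
      using abs_triangle_ineq4[of "p r" "p 1 * r"] r by (simp add: q_def abs_mult)
    also have "\<dots> \<le> B + \<bar>p 1\<bar> * e"
      using bd[OF r] r by (intro add_mono mult_left_mono) auto
    finally have "real (Suc m) * \<bar>q r\<bar> \<le> C"
      unfolding C_def by (intro mult_left_mono) auto
    moreover have "q s = real (Suc m) * q r"
      using qmult[OF r(1), of m] by (simp add: r_def)
    ultimately show ?thesis by (simp add: abs_mult)
  qed
  have bounded: "\<bar>q s\<bar> \<le> C" if s: "0 < s" for s
  proof -
    define n where "n = nat (\<lceil>s\<rceil> - 1)"
    have n: "real n = of_int \<lceil>s\<rceil> - 1" unfolding n_def using s by (simp add: of_nat_nat)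
    have "0 < s - real n" "s - real n \<le> 1" unfolding n by linarith+
    then show ?thesis using small[of "s - real n"] qper[of "s - real n" n] by simp
  qed
  have "q t = 0"
  proof (rule ccontr)
    assume "q t \<noteq> 0"
    then obtain n where n: "C < real n * \<bar>q t\<bar>"
      using reals_Archimedean3[of "\<bar>q t\<bar>"] by auto
    have "real n * \<bar>q t\<bar> \<le> real (Suc n) * \<bar>q t\<bar>" by (intro mult_right_mono) auto
    also have "\<dots> = \<bar>q (real (Suc n) * t)\<bar>" unfolding qmult[OF t] by (simp add: abs_mult)
    also have "\<dots> \<le> C" using t by (intro bounded) auto
    finally show False using n by simp
  qed
  then show ?thesis by (simp add: q_def)
qed

text \<open>
  A quantitative form of Steinhaus' argument. If \<open>\<bar>f\<bar> \<le> K\<close> on a subset \<open>E\<close> of a unit interval, of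
  measure greater than 3/4, then for \<open>t < 1/4\<close> the set \<open>E\<close> and its translate by \<open>- t\<close> lie in an
  interval of length less than 5/4, so they overlap in positive measure. The overlap contains an \<open>x\<close>
  with \<open>p t = f (x + t) - f x\<close>, and both values of \<open>f\<close> are at most \<open>K\<close> in absolute value.
\<close>

lemma increments_bounded:
  fixes f p :: "real \<Rightarrow> real"
  assumes f[measurable]: "f \<in> borel_measurable borel"
    and S: "{r<..<r + 1} \<subseteq> S"
    and inc: "\<And>t. 0 < t \<Longrightarrow> AE x in lborel. x \<in> S \<longrightarrow> f (x + t) - f x = p t"
  obtains B where "\<And>t. 0 < t \<Longrightarrow> t < 1/4 \<Longrightarrow> \<bar>p t\<bar> \<le> B"
proof -
  define E where "E = (\<lambda>K::nat. {x \<in> {r<..<r + 1}. \<bar>f x\<bar> \<le> real K})"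
  have E_sets[measurable]: "E K \<in> sets borel" for K
    unfolding E_def by measurable
  have E_Un: "(\<Union>K. E K) = {r<..<r + 1}"
    by (auto simp: E_def real_arch_simple)
  have "(\<lambda>K. measure lborel (E K)) \<longlonglongrightarrow> measure lborel (\<Union>K. E K)"
    by (intro Lim_measure_incseq) (auto simp: E_Un, auto simp: E_def incseq_def)
  then have "\<forall>\<^sub>F K in sequentially. 3/4 < measure lborel (E K)"
    unfolding E_Un by (rule order_tendstoD) simp
  then obtain K where K: "3/4 < measure lborel (E K)"
    by (auto simp: eventually_sequentially)
  have "\<bar>p t\<bar> \<le> 2 * real K" if t: "0 < t" "t < 1/4" for t
  proof -
    define E' where "E' = (\<lambda>x. t + x) -` E K"
    have "(\<lambda>x. t + x) \<in> borel_measurable borel" by measurable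
    then have E'_sets[measurable]: "E' \<in> sets borel"
      using measurable_sets[of "\<lambda>x. t + x" borel borel "E K"] E_sets[of K]
      by (simp add: E'_def)
    have E'_eq: "measure lborel E' = measure lborel (E K)"
    proof -
      have "measure lborel (E K) = measure (distr lborel borel ((+) t)) (E K)"
        by (simp add: lborel_distr_plus)
      also have "\<dots> = measure lborel E'"
        using E_sets by (subst measure_distr) (auto simp: E'_def)
      finally show ?thesis by simp
    qed
    have sub: "E K \<union> E' \<subseteq> {r - t<..<r + 1}"
      using t by (auto simp: E_def E'_def)
    have I: "{r - t<..<r + 1} \<in> fmeasurable lborel"
      using t by (simp add: fmeasurable_def)
    have fm: "E K \<in> fmeasurable lborel" "E' \<in> fmeasurable lborel"
      by (rule fmeasurableI2[OF I]; use sub E'_sets E_sets in auto)+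
    have "measure lborel (E K \<union> E') \<le> measure lborel {r - t<..<r + 1}"
      using sub fm by (intro measure_mono_fmeasurable[OF _ _ I]) (auto simp: fmeasurable_def)
    also have "\<dots> < 5/4" using t by simp
    finally have "measure lborel (E K \<union> E') < 5/4" .
    moreover have "measure lborel (E K \<union> E') = measure lborel (E K) + measure lborel E' - measure lborel (E K \<inter> E')"
      using measure_Un3[OF fm] .
    ultimately have pos: "0 < measure lborel (E K \<inter> E')"
      using K E'_eq by simp
    have "\<exists>x \<in> E K \<inter> E'. f (x + t) - f x = p t"
    proof (rule ccontr)
      assume neg: "\<not> ?thesis"
      have "AE x in lborel. x \<notin> E K \<inter> E'"
        using inc[OF t(1)] by eventually_elim (use neg S in \<open>auto simp: E_def\<close>)
      then have "E K \<inter> E' \<in> null_sets lborel"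
        using E_sets E'_sets by (subst AE_iff_null_sets) auto
      then have "measure lborel (E K \<inter> E') = 0"
        by (rule measure_eq_0_null_sets)
      then show False using pos by simp
    qed
    then obtain x where "x \<in> E K" "t + x \<in> E K" "f (x + t) - f x = p t"
      by (auto simp: E'_def)
    then show ?thesis by (auto simp: E_def add.commute)
  qed
  then show thesis by (rule that)
qed

text \<open>
  The set \<open>S\<close> ranges over half-lines and the whole line, because the lemma serves additively on
  \<open>{0<..}\<close> and, after passing to logarithms, on \<open>UNIV\<close>. The factor \<open>k\<close> is determined by \<open>p\<close>;
  this is how slopes of different functions are compared later.
\<close>

lemma affine_if_increments_constant:
  fixes f p :: "real \<Rightarrow> real"
  assumes f[measurable]: "f \<in> borel_measurable borel"
    and S[measurable]: "S \<in> sets borel"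
    and r: "r \<in> S" and up: "\<And>x t. x \<in> S \<Longrightarrow> 0 < t \<Longrightarrow> x + t \<in> S"
    and inc: "\<And>t. 0 < t \<Longrightarrow> AE x in lborel. x \<in> S \<longrightarrow> f (x + t) - f x = p t"
  shows "\<exists>k \<alpha>. (\<forall>t>0. p t = k * t) \<and> (AE x in lborel. x \<in> S \<longrightarrow> f x = k * x + \<alpha>)"
proof -
  have ray: "x \<in> S" if "r < x" for x
    using up[OF r, of "x - r"] that by simp
  then have sub: "{u<..<v} \<subseteq> S" if "r \<le> u" for u v
    using that by auto
  have add: "p (s + t) = p s + p t" if st: "0 < s" "0 < t" for s t
  proof -
    have 1: "AE x in lborel. x + s \<in> S \<longrightarrow> f (x + s + t) - f (x + s) = p t"
      using AE_lborel_translate[OF inc[OF st(2)]] .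
    have "0 < s + t" using st by simp
    note 2 = inc[OF this]
    have "AE x in lborel. x \<in> S \<longrightarrow> p (s + t) = p s + p t"
      using inc[OF st(1)] 1 2
      by eventually_elim (use up st in \<open>auto simp: add.assoc\<close>)
    from AE_lborel_ex[OF this, of r "r + 1"] sub show ?thesis by auto
  qed
  obtain B where B: "\<And>t. 0 < t \<Longrightarrow> t < 1/4 \<Longrightarrow> \<bar>p t\<bar> \<le> B"
    using increments_bounded[OF f sub inc] by blast
  define k where "k = p 1"
  have p: "p t = k * t" if "0 < t" for t
    unfolding k_def using additive_bounded_linear[of p "1/4" B t] add B that by simp
  define g where "g = (\<lambda>x. f x - k * x)"
  have g[measurable]: "g \<in> borel_measurable borel" unfolding g_def by measurable
  have "AE t in lborel. AE x in lborel. x \<in> S \<longrightarrow> 0 < t \<longrightarrow> g (x + t) = g x"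
  proof (rule AE_I2)
    fix t
    show "AE x in lborel. x \<in> S \<longrightarrow> 0 < t \<longrightarrow> g (x + t) = g x"
    proof (cases "0 < t")
      case True
      show ?thesis using inc[OF True]
        by eventually_elim (use p[OF True] in \<open>auto simp: g_def algebra_simps\<close>)
    qed simp
  qed
  then have inv: "AE x in lborel. AE t in lborel. x \<in> S \<longrightarrow> 0 < t \<longrightarrow> g (x + t) = g x"
    by (subst lborel_pair.AE_commute) measurable
  \<comment> \<open>Almost every point of \<open>S\<close> lies in \<open>G\<close>, and two points of \<open>G\<close> have the same value, since \<open>g\<close>
    takes each of the two values almost everywhere on a common half-line.\<close>
  define G where "G = {x. AE y in lborel. x < y \<longrightarrow> g y = g x}"
  have good: "AE x in lborel. x \<in> S \<longrightarrow> x \<in> G"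
    using inv
  proof eventually_elim
    case (elim x)
    show ?case
    proof
      assume "x \<in> S"
      then have "AE y in lborel. 0 < y + - x \<longrightarrow> g (x + (y + - x)) = g x"
        using AE_lborel_translate[OF elim, of "- x"] by simp
      then show "x \<in> G" unfolding G_def by simp
    qed
  qed
  have const: "g x = g x'" if "x \<in> G" "x' \<in> G" for x x'
  proof -
    let ?m = "max x x'"
    have "AE y in lborel. y \<in> {?m<..<?m + 1} \<longrightarrow> g x = g x'"
      using that[unfolded G_def mem_Collect_eq]
      by eventually_elim auto
    from AE_lborel_ex[OF this, of ?m "?m + 1"] show ?thesis by auto
  qed
  obtain x0 where x0: "x0 \<in> G"
    using AE_lborel_ex[OF good, of r "r + 1"] sub by auto
  have "AE x in lborel. x \<in> S \<longrightarrow> f x = k * x + g x0"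
    using good
  proof eventually_elim
    case (elim x)
    show ?case
    proof
      assume "x \<in> S"
      with elim x0 have "g x = g x0" by (intro const) auto
      then show "f x = k * x + g x0" by (simp add: g_def)
    qed
  qed
  with p show ?thesis by blast
qed

section \<open>The Pexider equation almost everywhere\<close>

text \<open>
  Fixing a generic \<open>x\<close> proves \<open>P\<close> almost everywhere on \<open>{x<..}\<close>, and generic \<open>x\<close> exist arbitrarily
  close to 0.
\<close>

lemma AE_lborel_of_sum:
  fixes P :: "real \<Rightarrow> bool"
  assumes "AE x in lborel. AE y in lborel. 0 < x \<longrightarrow> 0 < y \<longrightarrow> P (x + y)"
  shows "AE z in lborel. 0 < z \<longrightarrow> P z"
proof -
  have "AE z in lborel. 1 / real (Suc n) < z \<longrightarrow> P z" for n
  proof -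
    have "AE x in lborel. 0 < x \<longrightarrow> (AE y in lborel. 0 < y \<longrightarrow> P (x + y))"
      using assms by eventually_elim auto
    from AE_lborel_ex_pos[OF this, of "1 / real (Suc n)"]
    obtain x where x: "x < 1 / real (Suc n)" "AE y in lborel. 0 < y \<longrightarrow> P (x + y)"
      by auto
    show ?thesis
      using AE_lborel_translate[OF x(2), of "- x"] by eventually_elim (use x(1) in auto)
  qed
  then have "AE z in lborel. \<forall>n. 1 / real (Suc n) < z \<longrightarrow> P z"
    by (subst AE_all_countable) blast
  then show ?thesis
    by eventually_elim (use nat_approx_posE in blast)
qed

text \<open>
  The value \<open>h (x + y + s)\<close> is reached by moving either argument, so
  \<open>f (x + s) - f x = g (y + s) - g y\<close>. The two sides depend on different variables, hence
  both equal a constant \<open>p s\<close>, and \<open>f\<close> and \<open>g\<close> have constant increments with the same \<open>p\<close>.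
\<close>

lemma pexider_AE:
  fixes f g h :: "real \<Rightarrow> real"
  assumes f: "f \<in> borel_measurable borel" and g: "g \<in> borel_measurable borel"
    and eq: "AE x in lborel. AE y in lborel. 0 < x \<longrightarrow> 0 < y \<longrightarrow> f x + g y = h (x + y)"
  obtains k \<alpha> \<beta> where "AE x in lborel. 0 < x \<longrightarrow> f x = k * x + \<alpha>"
    and "AE x in lborel. 0 < x \<longrightarrow> g x = k * x + \<beta>"
    and "AE x in lborel. 0 < x \<longrightarrow> h x = k * x + (\<alpha> + \<beta>)"
proof -
  have "\<exists>p. (AE x in lborel. x \<in> {0<..} \<longrightarrow> f (x + s) - f x = p) \<and>
            (AE y in lborel. y \<in> {0<..} \<longrightarrow> g (y + s) - g y = p)" if s: "0 < s" for s
  proof -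
    have 1: "AE x in lborel. AE y in lborel. 0 < x + s \<longrightarrow> 0 < y \<longrightarrow> f (x + s) + g y = h (x + s + y)"
      using AE_lborel_translate[OF eq] .
    have 2: "AE x in lborel. AE y in lborel. 0 < x \<longrightarrow> 0 < y + s \<longrightarrow> f x + g (y + s) = h (x + (y + s))"
      using eq by eventually_elim (rule AE_lborel_translate)
    have 3: "AE x in lborel. 0 < x \<longrightarrow> (AE y in lborel. 0 < y \<longrightarrow> f (x + s) - f x = g (y + s) - g y)"
      using 1 2
    proof eventually_elim
      case (elim x)
      show ?case
      proof
        assume x: "0 < x"
        from elim show "AE y in lborel. 0 < y \<longrightarrow> f (x + s) - f x = g (y + s) - g y"
        proof eventually_elim
          case (elim y)
          have "x + s + y = x + (y + s)" by simp
          with elim show ?case using x s by auto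
        qed
      qed
    qed
    obtain x0 where x0: "AE y in lborel. 0 < y \<longrightarrow> f (x0 + s) - f x0 = g (y + s) - g y"
      using AE_lborel_ex_pos[OF 3, of 1] by auto
    have "AE x in lborel. 0 < x \<longrightarrow> f (x + s) - f x = f (x0 + s) - f x0"
      using 3
    proof eventually_elim
      case (elim x)
      show ?case
      proof
        assume "0 < x"
        with elim have "AE y in lborel. 0 < y \<longrightarrow> f (x + s) - f x = g (y + s) - g y" by simp
        then have "AE y in lborel. 0 < (y::real) \<longrightarrow> f (x + s) - f x = f (x0 + s) - f x0"
          using x0 by eventually_elim auto
        from AE_lborel_ex_pos[OF this, of 1] show "f (x + s) - f x = f (x0 + s) - f x0" by auto
      qed
    qed
    moreover have "AE y in lborel. 0 < y \<longrightarrow> g (y + s) - g y = f (x0 + s) - f x0"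
      using x0 by eventually_elim auto
    ultimately show ?thesis by auto
  qed
  then have "\<forall>s. \<exists>p. 0 < s \<longrightarrow>
      (AE x in lborel. x \<in> {0<..} \<longrightarrow> f (x + s) - f x = p) \<and>
      (AE y in lborel. y \<in> {0<..} \<longrightarrow> g (y + s) - g y = p)"
    by blast
  from choice[OF this] obtain p where
    pf: "\<And>s. 0 < s \<Longrightarrow> AE x in lborel. x \<in> {0<..} \<longrightarrow> f (x + s) - f x = p s" and
    pg: "\<And>s. 0 < s \<Longrightarrow> AE x in lborel. x \<in> {0<..} \<longrightarrow> g (x + s) - g x = p s"
    by blast
  have "\<exists>k \<alpha>. (\<forall>t>0. p t = k * t) \<and> (AE x in lborel. x \<in> {0<..} \<longrightarrow> f x = k * x + \<alpha>)"
    by (rule affine_if_increments_constant[OF f _ _ _ pf, where r = 1]) simp_all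
  then obtain k \<alpha> where k: "\<forall>t>0. p t = k * t"
    and \<alpha>: "AE x in lborel. x \<in> {0<..} \<longrightarrow> f x = k * x + \<alpha>"
    by blast
  have "\<exists>k \<beta>. (\<forall>t>0. p t = k * t) \<and> (AE x in lborel. x \<in> {0<..} \<longrightarrow> g x = k * x + \<beta>)"
    by (rule affine_if_increments_constant[OF g _ _ _ pg, where r = 1]) simp_all
  then obtain k' \<beta> where k': "\<forall>t>0. p t = k' * t"
    and "AE x in lborel. x \<in> {0<..} \<longrightarrow> g x = k' * x + \<beta>"
    by blast
  moreover have "k' = k"
    using k k' by (metis mult.right_neutral zero_less_one)
  ultimately have \<beta>: "AE x in lborel. x \<in> {0<..} \<longrightarrow> g x = k * x + \<beta>"
    by simp
  have "AE x in lborel. AE y in lborel. 0 < x \<longrightarrow> 0 < y \<longrightarrow> h (x + y) = k * (x + y) + (\<alpha> + \<beta>)"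
    using eq \<alpha>
  proof eventually_elim
    case (elim x)
    show ?case using elim(1) \<beta>
      by eventually_elim (use elim(2) in \<open>auto simp: algebra_simps\<close>)
  qed
  then have "AE x in lborel. 0 < x \<longrightarrow> h x = k * x + (\<alpha> + \<beta>)"
    by (rule AE_lborel_of_sum)
  with \<alpha> \<beta> show thesis by (intro that) auto
qed

section \<open>Removing the quotient term by dilations\<close>

lemma AE_lborel_dilate:
  fixes s :: real
  assumes "AE x in lborel. 0 < x \<longrightarrow> P x" "0 < s"
  shows "AE x in lborel. 0 < x \<longrightarrow> P (s * x)"
  using AE_lborel_scale[OF assms(1), of s] assms(2) by (simp add: zero_less_mult_iff)

text \<open>
  The cocycle identity \<open>l (t * s) = l t * s + l s\<close> and its mirror image, taken at \<open>s = 2\<close>, give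
  \<open>l t = l 2 * (t - 1)\<close>. Thus \<open>l 2 * x\<close> has the dilation increments \<open>l t * x\<close>, and what remains
  of \<open>a\<close> is a function of \<open>u = ln x\<close> with constant increments \<open>p (exp v)\<close>. Stating the value
  of \<open>p\<close> in the conclusion allows the logarithmic coefficients of \<open>a\<close>, \<open>b\<close> and \<open>c\<close> to be related.
\<close>

lemma dilation_increments:
  fixes a l p :: "real \<Rightarrow> real"
  assumes a[measurable]: "a \<in> borel_measurable borel"
    and inc: "\<And>t. 0 < t \<Longrightarrow> AE x in lborel. 0 < x \<longrightarrow> a (t * x) - a x = l t * x + p t"
  shows "\<exists>\<kappa> \<alpha>. (\<forall>v>0. p (exp v) = \<kappa> * v) \<and>
    (AE x in lborel. 0 < x \<longrightarrow> a x = l 2 * x + \<kappa> * ln x + \<alpha>)"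
proof -
  have cocycle: "l (t * s) = l t * s + l s" if st: "0 < s" "0 < t" for s t
  proof -
    have "0 < t * s" using st by simp
    note 1 = inc[OF this] and 2 = AE_lborel_dilate[OF inc[OF st(2)] st(1)]
    have "AE x in lborel. 0 < x \<longrightarrow> l (t * s) * x + p (t * s) = (l t * s + l s) * x + (p t + p s)"
      using 1 2 inc[OF st(1)]
    proof eventually_elim
      case (elim x)
      then show ?case by (auto simp: algebra_simps)
    qed
    then show ?thesis by (rule affine_AE_eq(1))
  qed
  define L where "L = l 2"
  have l: "l t = L * (t - 1)" if "0 < t" for t
    using cocycle[of t 2] cocycle[of 2 t] that by (simp add: L_def algebra_simps)
  define F where "F = (\<lambda>u. a (exp u) - L * exp u)"
  have F: "F \<in> borel_measurable borel" unfolding F_def by measurable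
  have incF: "AE u in lborel. u \<in> UNIV \<longrightarrow> F (u + v) - F u = p (exp v)" for v
  proof -
    have "AE u in lborel. u \<in> UNIV \<longrightarrow> (0 < exp u \<longrightarrow>
        a (exp v * exp u) - a (exp u) = l (exp v) * exp u + p (exp v))"
      by (rule AE_lborel_substitution[OF inc, where g = ln and T = "{0<..}"])
        (use has_field_derivative_at_within[OF DERIV_ln] in
          \<open>auto simp: differentiable_on_def real_differentiable_def\<close>)
    then show ?thesis
      by eventually_elim (auto simp: F_def l exp_add algebra_simps)
  qed
  have "\<exists>k \<alpha>. (\<forall>v>0. p (exp v) = k * v) \<and> (AE u in lborel. u \<in> UNIV \<longrightarrow> F u = k * u + \<alpha>)"
    by (rule affine_if_increments_constant[OF F _ _ _ incF]) simp_all
  then obtain k \<alpha> where k: "\<forall>v>0. p (exp v) = k * v"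
    and \<alpha>: "AE u in lborel. F u = k * u + \<alpha>"
    by auto
  have "AE x in lborel. x \<in> {0<..} \<longrightarrow> F (ln x) = k * ln x + \<alpha>"
    by (rule AE_lborel_substitution[OF \<alpha>, where g = exp and T = UNIV])
      (auto simp: differentiable_on_def real_differentiable_def intro!: DERIV_exp)
  then have "AE x in lborel. 0 < x \<longrightarrow> a x = L * x + k * ln x + \<alpha>"
    by eventually_elim (auto simp: F_def)
  with k show ?thesis unfolding L_def by blast
qed

text \<open>
  The null set is used only through its sections: for almost every \<open>x\<close> the equation holds for
  almost every \<open>y\<close>. In this form separate substitutions in \<open>x\<close> and \<open>y\<close> need only the
  one-dimensional transport of null sets.
\<close>

lemma functional_equation_AE:
  fixes a b c d :: "real \<Rightarrow> real"
  assumes a[measurable]: "a \<in> borel_measurable borel"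
    and b[measurable]: "b \<in> borel_measurable borel"
    and c[measurable]: "c \<in> borel_measurable borel"
    and eq: "AE x in lborel. AE y in lborel. 0 < x \<longrightarrow> 0 < y \<longrightarrow> a x + b y = c (x + y) + d (x / y)"
  shows "\<exists>\<Lambda> \<kappa>\<^sub>1 \<kappa>\<^sub>2 \<alpha> \<beta> \<gamma> \<delta>. \<alpha> + \<beta> = \<gamma> + \<delta> \<and>
     (AE x in lborel. 0 < x \<longrightarrow>
        a x = \<Lambda> * x + \<kappa>\<^sub>1 * ln x + \<alpha> \<and>
        b x = \<Lambda> * x + \<kappa>\<^sub>2 * ln x + \<beta> \<and>
        c x = \<Lambda> * x + (\<kappa>\<^sub>1 + \<kappa>\<^sub>2) * ln x + \<gamma> \<and>
        d x = \<kappa>\<^sub>1 * ln (x / (x + 1)) - \<kappa>\<^sub>2 * ln (1 + x) + \<delta>)"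
proof -
  have *: "\<exists>l p q. (AE x in lborel. 0 < x \<longrightarrow> a (t * x) - a x = l * x + p) \<and>
      (AE x in lborel. 0 < x \<longrightarrow> b (t * x) - b x = l * x + q) \<and>
      (AE x in lborel. 0 < x \<longrightarrow> c (t * x) - c x = l * x + (p + q))" if t: "0 < t" for t
  proof -
    have "AE x in lborel. AE y in lborel. 0 < t * x \<longrightarrow> 0 < t * y \<longrightarrow>
        a (t * x) + b (t * y) = c (t * x + t * y) + d ((t * x) / (t * y))"
    proof -
      have "AE x in lborel. AE y in lborel. 0 < t * x \<longrightarrow> 0 < y \<longrightarrow>
          a (t * x) + b y = c (t * x + y) + d ((t * x) / y)"
        by (rule AE_lborel_scale[OF eq]) (use t in simp)
      then show ?thesis
        by eventually_elim (rule AE_lborel_scale, assumption, use t in simp)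
    qed
    with eq have 1: "AE x in lborel. AE y in lborel. 0 < x \<longrightarrow> 0 < y \<longrightarrow>
        (a (t * x) - a x) + (b (t * y) - b y) = c (t * (x + y)) - c (x + y)"
    proof eventually_elim
      case (elim x)
      then show ?case
      proof eventually_elim
        case (elim y)
        have "t * x / (t * y) = x / y" using t by simp
        then show ?case using elim t by (auto simp: distrib_left)
      qed
    qed
    have "(\<lambda>x. a (t * x) - a x) \<in> borel_measurable borel" by measurable
    moreover have "(\<lambda>x. b (t * x) - b x) \<in> borel_measurable borel" by measurable
    ultimately obtain l p q where "AE x in lborel. 0 < x \<longrightarrow> a (t * x) - a x = l * x + p"
      "AE x in lborel. 0 < x \<longrightarrow> b (t * x) - b x = l * x + q"
      "AE x in lborel. 0 < x \<longrightarrow> c (t * x) - c x = l * x + (p + q)"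
      by (rule pexider_AE[where h = "\<lambda>x. c (t * x) - c x"]) (rule 1)
    then show ?thesis by blast
  qed
  \<comment> \<open>The coefficients for each \<open>t\<close> are chosen together, as a triple, so that \<open>a\<close>, \<open>b\<close> and \<open>c\<close> share the slope.\<close>
  have "\<forall>t. \<exists>w :: real \<times> real \<times> real. 0 < t \<longrightarrow>
      (AE x in lborel. 0 < x \<longrightarrow> a (t * x) - a x = fst w * x + fst (snd w)) \<and>
      (AE x in lborel. 0 < x \<longrightarrow> b (t * x) - b x = fst w * x + snd (snd w)) \<and>
      (AE x in lborel. 0 < x \<longrightarrow> c (t * x) - c x = fst w * x + (fst (snd w) + snd (snd w)))"
    (is "\<forall>t. ?W t")
  proof (intro allI)
    fix t
    show "?W t"
    proof (cases "0 < t")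
      case True
      from *[OF this] obtain l p q where "AE x in lborel. 0 < x \<longrightarrow> a (t * x) - a x = l * x + p"
        "AE x in lborel. 0 < x \<longrightarrow> b (t * x) - b x = l * x + q"
        "AE x in lborel. 0 < x \<longrightarrow> c (t * x) - c x = l * x + (p + q)"
        by blast
      then show ?thesis by (intro exI[of _ "(l, p, q)"]) simp
    qed simp
  qed
  from choice[OF this] obtain w :: "real \<Rightarrow> real \<times> real \<times> real" where w: "\<forall>t. 0 < t \<longrightarrow>
      (AE x in lborel. 0 < x \<longrightarrow> a (t * x) - a x = fst (w t) * x + fst (snd (w t))) \<and>
      (AE x in lborel. 0 < x \<longrightarrow> b (t * x) - b x = fst (w t) * x + snd (snd (w t))) \<and>
      (AE x in lborel. 0 < x \<longrightarrow> c (t * x) - c x = fst (w t) * x + (fst (snd (w t)) + snd (snd (w t))))"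
    ..
  define l where "l = (\<lambda>t. fst (w t))"
  define p where "p = (\<lambda>t. fst (snd (w t)))"
  define q where "q = (\<lambda>t. snd (snd (w t)))"
  obtain \<kappa>\<^sub>1 \<alpha> where \<kappa>1: "\<forall>v>0. p (exp v) = \<kappa>\<^sub>1 * v"
    and aeq: "AE x in lborel. 0 < x \<longrightarrow> a x = l 2 * x + \<kappa>\<^sub>1 * ln x + \<alpha>"
    using dilation_increments[OF a, of l p] w unfolding l_def p_def by blast
  obtain \<kappa>\<^sub>2 \<beta> where \<kappa>2: "\<forall>v>0. q (exp v) = \<kappa>\<^sub>2 * v"
    and beq: "AE x in lborel. 0 < x \<longrightarrow> b x = l 2 * x + \<kappa>\<^sub>2 * ln x + \<beta>"
    using dilation_increments[OF b, of l q] w unfolding l_def q_def by blast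
  obtain \<kappa>\<^sub>3 \<gamma> where \<kappa>3: "\<forall>v>0. p (exp v) + q (exp v) = \<kappa>\<^sub>3 * v"
    and ceq': "AE x in lborel. 0 < x \<longrightarrow> c x = l 2 * x + \<kappa>\<^sub>3 * ln x + \<gamma>"
    using dilation_increments[OF c, of l "\<lambda>t. p t + q t"] w unfolding l_def p_def q_def by blast
  have \<kappa>3_eq: "\<kappa>\<^sub>3 = \<kappa>\<^sub>1 + \<kappa>\<^sub>2"
    using \<kappa>1[rule_format, of 1] \<kappa>2[rule_format, of 1] \<kappa>3[rule_format, of 1] by simp
  have ceq: "AE x in lborel. 0 < x \<longrightarrow> c x = l 2 * x + (\<kappa>\<^sub>1 + \<kappa>\<^sub>2) * ln x + \<gamma>"
    using ceq' unfolding \<kappa>3_eq .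
  define \<delta> where "\<delta> = \<alpha> + \<beta> - \<gamma>"
  define D where "D = (\<lambda>r. \<kappa>\<^sub>1 * ln (r / (r + 1)) - \<kappa>\<^sub>2 * ln (1 + r) + \<delta>)"
  have "AE x in lborel. 0 < x \<longrightarrow> (AE y in lborel. 0 < y \<longrightarrow> d (x / y) = D (x / y))"
    using eq aeq
  proof eventually_elim
    case (elim x)
    show ?case
    proof
      assume x: "0 < x"
      have "AE y in lborel. 0 < y + x \<longrightarrow> c (y + x) = l 2 * (y + x) + (\<kappa>\<^sub>1 + \<kappa>\<^sub>2) * ln (y + x) + \<gamma>"
        using AE_lborel_translate[OF ceq] .
      with elim(1) beq show "AE y in lborel. 0 < y \<longrightarrow> d (x / y) = D (x / y)"
      proof eventually_elim
        case (elim y)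
        show ?case
        proof
          assume y: "0 < y"
          have "(x / y) / (x / y + 1) = x / (y + x)" "1 + x / y = (y + x) / y"
            using x y by (auto simp: field_simps)
          then have "D (x / y) = \<kappa>\<^sub>1 * (ln x - ln (y + x)) - \<kappa>\<^sub>2 * (ln (y + x) - ln y) + \<delta>"
            unfolding D_def using x y by (simp add: ln_div)
          moreover have "d (x / y) = a x + b y - c (y + x)"
            using elim(1) x y by (simp add: add.commute)
          ultimately show "d (x / y) = D (x / y)"
            using elim \<open>0 < x \<longrightarrow> a x = _\<close> x y by (simp add: \<delta>_def algebra_simps)
        qed
      qed
    qed
  qed
  from AE_lborel_ex_pos[OF this, of 1] obtain x0 where x0: "0 < x0"
    and d0: "AE y in lborel. 0 < y \<longrightarrow> d (x0 / y) = D (x0 / y)"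
    by auto
  have "AE r in lborel. r \<in> {0<..} \<longrightarrow> (0 < x0 / r \<longrightarrow> d (x0 / (x0 / r)) = D (x0 / (x0 / r)))"
    by (rule AE_lborel_substitution[OF d0, where g = "\<lambda>y. x0 / y" and T = "{0<..}"])
      (use x0 in \<open>auto simp: differentiable_on_def intro!: derivative_intros\<close>)
  then have deq: "AE r in lborel. 0 < r \<longrightarrow> d r = D r"
    by eventually_elim (use x0 in auto)
  have "AE x in lborel. 0 < x \<longrightarrow>
        a x = l 2 * x + \<kappa>\<^sub>1 * ln x + \<alpha> \<and>
        b x = l 2 * x + \<kappa>\<^sub>2 * ln x + \<beta> \<and>
        c x = l 2 * x + (\<kappa>\<^sub>1 + \<kappa>\<^sub>2) * ln x + \<gamma> \<and>
        d x = \<kappa>\<^sub>1 * ln (x / (x + 1)) - \<kappa>\<^sub>2 * ln (1 + x) + \<delta>"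
    using aeq beq ceq deq by eventually_elim (auto simp: D_def)
  moreover have "\<alpha> + \<beta> = \<gamma> + \<delta>" by (simp add: \<delta>_def)
  ultimately show ?thesis by blast
qed

theorem proposition2:
  fixes a b c d :: "real \<Rightarrow> real"
  assumes "a \<in> borel_measurable (restrict_space borel {0<..})"
    and "b \<in> borel_measurable (restrict_space borel {0<..})"
    and "c \<in> borel_measurable (restrict_space borel {0<..})"
    and "d \<in> borel_measurable (restrict_space borel {0<..})"
    and "\<exists>M :: (real \<times> real) set. M \<in> sets lebesgue \<and> M \<subseteq> {0<..} \<times> {0<..} \<and> emeasure lebesgue M = 0 \<and>
           (\<forall>(x, y) \<in> ({0<..} \<times> {0<..}) - M. a x + b y = c (x + y) + d (x / y))"
  shows "\<exists>\<Lambda> \<kappa>\<^sub>1 \<kappa>\<^sub>2 \<alpha> \<beta> \<gamma> \<delta>. \<alpha> + \<beta> = \<gamma> + \<delta> \<and>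
           (AE x in lebesgue_on {0<..}.
              a x = \<Lambda> * x + \<kappa>\<^sub>1 * ln x + \<alpha> \<and>
              b x = \<Lambda> * x + \<kappa>\<^sub>2 * ln x + \<beta> \<and>
              c x = \<Lambda> * x + (\<kappa>\<^sub>1 + \<kappa>\<^sub>2) * ln x + \<gamma> \<and>
              d x = \<kappa>\<^sub>1 * ln (x / (x + 1)) - \<kappa>\<^sub>2 * ln (1 + x) + \<delta>)"
proof -
  \<comment> \<open>Extension by 0 turns measurability on the half-line into measurability on the line.\<close>
  define ext :: "(real \<Rightarrow> real) \<Rightarrow> real \<Rightarrow> real" where
    "ext = (\<lambda>f x. indicator {0<..} x *\<^sub>R f x)"
  have ext_pos: "ext f x = f x" if "0 < x" for f x
    using that by (simp add: ext_def)
  have ext_borel: "ext f \<in> borel_measurable borel"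
    if "f \<in> borel_measurable (restrict_space borel {0<..})" for f
    using that unfolding ext_def by (subst (asm) borel_measurable_restrict_space_iff) auto
  obtain M :: "(real \<times> real) set" where M: "M \<in> null_sets lebesgue"
    and eqM: "\<forall>(x, y) \<in> ({0<..} \<times> {0<..}) - M. a x + b y = c (x + y) + d (x / y)"
    using assms(5) by auto
  have "AE z in lborel. z \<notin> M"
    using AE_not_in[OF M] by (simp add: AE_completion_iff)
  then have "AE z in (lborel :: real measure) \<Otimes>\<^sub>M (lborel :: real measure). z \<notin> M"
    by (simp only: lborel_prod)
  then have "AE x in lborel. AE y in lborel. (x, y) \<notin> M"
    by (rule lborel_pair.AE_pair)
  then have "AE x in lborel. AE y in lborel. 0 < x \<longrightarrow> 0 < y \<longrightarrow>
      ext a x + ext b y = ext c (x + y) + ext d (x / y)"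
  proof eventually_elim
    case (elim x)
    then show ?case
      by eventually_elim (use eqM in \<open>auto simp: ext_pos\<close>)
  qed
  from functional_equation_AE[OF assms(1-3)[THEN ext_borel] this]
  obtain \<Lambda> \<kappa>\<^sub>1 \<kappa>\<^sub>2 \<alpha> \<beta> \<gamma> \<delta> where sum: "\<alpha> + \<beta> = \<gamma> + \<delta>"
    and sol: "AE x in lborel. 0 < x \<longrightarrow>
        ext a x = \<Lambda> * x + \<kappa>\<^sub>1 * ln x + \<alpha> \<and>
        ext b x = \<Lambda> * x + \<kappa>\<^sub>2 * ln x + \<beta> \<and>
        ext c x = \<Lambda> * x + (\<kappa>\<^sub>1 + \<kappa>\<^sub>2) * ln x + \<gamma> \<and>
        ext d x = \<kappa>\<^sub>1 * ln (x / (x + 1)) - \<kappa>\<^sub>2 * ln (1 + x) + \<delta>"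
    by blast
  have "AE x in lborel. x \<in> {0<..} \<longrightarrow>
        a x = \<Lambda> * x + \<kappa>\<^sub>1 * ln x + \<alpha> \<and>
        b x = \<Lambda> * x + \<kappa>\<^sub>2 * ln x + \<beta> \<and>
        c x = \<Lambda> * x + (\<kappa>\<^sub>1 + \<kappa>\<^sub>2) * ln x + \<gamma> \<and>
        d x = \<kappa>\<^sub>1 * ln (x / (x + 1)) - \<kappa>\<^sub>2 * ln (1 + x) + \<delta>"
    using sol by eventually_elim (auto simp: ext_pos)
  then have "AE x in lebesgue_on {0<..}.
        a x = \<Lambda> * x + \<kappa>\<^sub>1 * ln x + \<alpha> \<and>
        b x = \<Lambda> * x + \<kappa>\<^sub>2 * ln x + \<beta> \<and>
        c x = \<Lambda> * x + (\<kappa>\<^sub>1 + \<kappa>\<^sub>2) * ln x + \<gamma> \<and>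
        d x = \<kappa>\<^sub>1 * ln (x / (x + 1)) - \<kappa>\<^sub>2 * ln (1 + x) + \<delta>"
    by (subst AE_restrict_space_iff) (auto simp: AE_completion_iff)
  with sum show ?thesis by blast
qed

end
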